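(* Let $n$ be a positive odd integer, and for $k\geqslant 0$ let $$c_q(k)=[4k+1]\frac{(q;q^2)_k^4}{(q^2;q^2)_k^4}.$$ Then $$\sum_{k=0}^{n-1}\sum_{j=0}^{k}c_q(j)c_q(k-j)\equiv q^{1-n}[n]^2\pmod{[n]\Phi_n(q)^3}.$$
   Context: Here $q$ is an indeterminate. The $q$-shifted factorial is $(x;q)_0=1$ and $(x;q)_m=(1-x)(1-xq)\cdots(1-xq^{m-1})$ for $m\geqslant1$; the $q$-integer is $[m]=1+q+\cdots+q^{m-1}=(1-q^m)/(1-q)$. $\Phi_n(q)$ denotes the $n$-th cyclotomic polynomial. For rational functions $A,B$ in $q$ and a polynomial $P$, $A\equiv B\pmod{P}$ means that $A-B=P\cdot U/V$ for polynomials $U,V$ with $V$ coprime to $P$. *)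

theory Defs
  imports Complex_Main "HOL-Computational_Algebra.Polynomial_Factorial"
begin

text \<open>
  Polynomials in the indeterminate \<open>q\<close> are complex polynomials and rational functions in
  \<open>q\<close> are elements of \<open>complex poly fract\<close>.  Complex coefficients let \<open>\<Phi>\<^sub>n\<close> be written as the
  product over the primitive \<open>n\<close>-th roots of unity.  Divisibility and coprimality of rational
  polynomials are unaffected by extending the coefficient field, so for rational functions over
  the rationals the congruence below is the same relation as over the rationals.
\<close>

definition qpoch :: "'a::comm_ring_1 \<Rightarrow> 'a \<Rightarrow> nat \<Rightarrow> 'a" where
  "qpoch x q m = (\<Prod>i<m. 1 - x * q ^ i)"

definition qint :: "'a::comm_semiring_1 \<Rightarrow> nat \<Rightarrow> 'a" where
  "qint q m = (\<Sum>i<m. q ^ i)"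

definition indet :: "complex poly" where
  "indet = [:0, 1:]"

definition cyclotomic :: "nat \<Rightarrow> complex poly" where
  "cyclotomic n =
     (\<Prod>k\<in>{k. 1 \<le> k \<and> k \<le> n \<and> coprime k n}. [:- cis (2 * pi * real k / real n), 1:])"

definition ratfun_cong ::
  "complex poly fract \<Rightarrow> complex poly fract \<Rightarrow> complex poly \<Rightarrow> bool" where
  "ratfun_cong A B P \<longleftrightarrow>
     (\<exists>U V. V \<noteq> 0 \<and> coprime V P \<and> A - B = to_fract P * (to_fract U / to_fract V))"

definition c :: "'a::field \<Rightarrow> nat \<Rightarrow> 'a" where
  "c q k = qint q (4 * k + 1) * qpoch q (q ^ 2) k ^ 4 / qpoch (q ^ 2) (q ^ 2) k ^ 4"

end

theory Submission
  imports Defs "HOL-Computational_Algebra.Normalized_Fraction"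
    "HOL-Computational_Algebra.Field_as_Ring"
begin

text \<open>
  The modulus splits into linear factors, so it suffices to bound the order of vanishing of the
  difference at each root of unity \<open>z \<noteq> 1\<close> of order \<open>d\<close> dividing \<open>n\<close>.

  At \<open>z\<close> one has \<open>c (a d + b) = W a * c b\<close> for \<open>b < d\<close>, where \<open>c b = 0\<close> for \<open>(d - 1)/2 < b < d\<close> and
  \<open>c ((d - 1)/2 - b) = - c b\<close>.  Hence the double sum contains the factor
  \<open>(\<Sum>b<d. c b)\<^sup>2 = 0\<close> at \<open>z\<close>.

  For \<open>d = n = 2 N + 1\<close> the terms with \<open>N < k < n\<close> vanish to order 4, so the double sum is \<open>S\<^sup>2\<close> to order 4,
  with \<open>S = (\<Sum>k\<le>N. c k)\<close>.  Replacing two of the four parameters \<open>q\<close> by \<open>q\<^sup>1\<^sup>+\<^sup>n\<close> and \<open>q\<^sup>1\<^sup>-\<^sup>n\<close> turns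
  \<open>S\<close> into a summable very-well-poised series with sum \<open>[n] / q\<^sup>N\<close>.  With \<open>y = (1 - q\<^sup>n)\<^sup>2 / q\<^sup>n\<close> this
  multiplies \<open>c k\<close> by \<open>1 + y * L k + O(y\<^sup>2)\<close>, and \<open>L (N - k) = L k\<close> at \<open>z\<close> while \<open>c (N - k) = - c k\<close>.
  Thus \<open>S - [n] / q\<^sup>N\<close> vanishes to order 3, and \<open>S\<^sup>2 - ([n] / q\<^sup>N)\<^sup>2\<close> to order 4.
\<close>

subsection \<open>A terminating very-well-poised sum\<close>

text \<open>With \<open>w = q^(2*i)\<close> this is the term ratio, apart from the factor
  \<open>1 - q*w^2\<close>, of the very-well-poised 6-phi-5 series in base \<open>q^2\<close> with a
  = b = q, the two other parameters \<open>q*Z\<close> and \<open>q/Z\<close>, and argument 1.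
  Writing \<open>Z - q*w\<close> for \<open>1 - q*w/Z\<close> avoids dividing by
  \<open>Z\<close>.\<close>

definition wp_ratio :: "'a::field \<Rightarrow> 'a \<Rightarrow> 'a \<Rightarrow> 'a" where
  "wp_ratio q Z w = (1 - q*w)^2 * ((1 - Z * (q*w)) * (Z - q*w)) /
     ((1 - q^2*w)^2 * ((1 - Z * (q^2*w)) * (Z - q^2*w)))"

definition wp_prod :: "'a::field \<Rightarrow> 'a \<Rightarrow> nat \<Rightarrow> 'a" where
  "wp_prod q Z k = (\<Prod>i<k. wp_ratio q Z (q ^ (2*i)))"

lemma wp_ratio_shift:
  fixes q Z w :: "'a::field"
  assumes IH: "A * ((1 - Z) * (1 - Z * (q^2*w)) * (q * Z - w)) =
     B * ((1 - Z * q^2) * (1 - Z * (q*w)) * (Z - w))"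
  and nz: "q \<noteq> 0" "Z \<noteq> 1" "q*Z \<noteq> w" "Z*(q^2*w) \<noteq> 1" "Z*(q^4*w) \<noteq> 1" "Z \<noteq> w" "Z \<noteq> q^2*w" "q^2*w \<noteq> 1"
  shows "A * wp_ratio q (Z*q^2) w
   * ((1 - Z) * (1 - Z * (q^2*(q^2*w))) * (q * Z - q^2*w))
   = B * wp_ratio q Z w * ((1 - Z * q^2) * (1 - Z * (q*(q^2*w))) * (Z - q^2*w))"
proof -
  \<comment> \<open>Each factor becomes an opaque variable, so that only cancellation remains; the
    powers of \<open>q\<close> extracted by \<open>f\<close> cancel as well.\<close>
  have step: "A * (a2 * (a3 * (q*x)) / (b2*(a4*(q^2*zw)))) * (u*a4*(q*v)) = B*(a2*(a1*v)/(b2*(a22*x2))) * (t*a3*x2)"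
    if "A*(u*a22*x) = B*(t*a1*zw)" "u \<noteq> 0" "a22 \<noteq> 0" "x \<noteq> 0" "b2 \<noteq> 0" "a4 \<noteq> 0" "zw \<noteq> 0" "x2 \<noteq> 0"
    for a2 a3 x b2 a4 zw u v a1 a22 x2 t :: 'a
  proof -
    from that nz(1) show ?thesis by (simp add: divide_simps power2_eq_square mult_ac)
  qed
  have f: "Z*q^2 - q*w = q*(q*Z-w)" "Z*q^2 - q^2*w = q^2*(Z-w)" "q*Z - q^2*w = q*(Z-q*w)"
      "1 - Z*q^2*(q*w) = 1 - Z * (q*(q^2*w))" "1 - Z*q^2*(q^2*w) = 1 - Z * (q^2*(q^2*w))"
    by (simp_all add: algebra_simps power2_eq_square)
  have g: "Z*(q^2*(q^2*w)) = Z*(q^4*w)" by (simp add: power2_eq_square power4_eq_xxxx mult_ac)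
  show ?thesis unfolding wp_ratio_def f
    by (rule step[OF IH]) (use nz g in auto)
qed

lemma power_inj_if_no_root_of_unity:
  fixes q :: "'a::field"
  assumes q: "q \<noteq> 0" "\<And>i. i > 0 \<Longrightarrow> q ^ i \<noteq> 1" and "i \<noteq> j"
  shows "q ^ i \<noteq> q ^ j"
proof -
  have "q ^ i \<noteq> q ^ j" if "i < j" for i j
  proof
    assume "q ^ i = q ^ j"
    then have "q ^ (j - i) = 1" using q(1) that by (simp add: power_diff)
    then show False using q(2)[of "j-i"] that by simp
  qed
  then show ?thesis using assms(3) by (metis nat_neq_iff)
qed

lemma wp_prod_Suc: "wp_prod q Z (Suc k) = wp_prod q Z k * wp_ratio q Z (q ^ (2*k))"
  by (simp add: wp_prod_def)

text \<open>The factors containing \<open>Z\<close> advance in steps of \<open>q^2\<close>, so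
  replacing \<open>Z\<close> by \<open>Z*q^2\<close> moves the products by one place and changes
  only their end factors.\<close>

lemma wp_prod_shift:
  fixes q Z :: "'a::field"
  assumes q: "q \<noteq> 0" "\<And>i. i > 0 \<Longrightarrow> q ^ i \<noteq> 1" and Z: "Z = q ^ (2*N+1)" and "k \<le> N"
  shows "wp_prod q (Z*q^2) k * ((1 - Z) * (1 - Z * (q^2*q^(2*k))) * (q * Z - q^(2*k))) =
     wp_prod q Z k * ((1 - Z * q^2) * (1 - Z * (q*q^(2*k))) * (Z - q^(2*k)))"
  using \<open>k \<le> N\<close>
proof (induction k)
  case 0
  show ?case by (simp add: wp_prod_def algebra_simps)
next
  case (Suc k)
  note inj = power_inj_if_no_root_of_unity[OF q]
  have e: "q^(2*Suc k) = q^2 * q^(2*k)" by (simp add: power_add[symmetric])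
  have "Z \<noteq> 1" "Z * (q^2 * q^(2*k)) \<noteq> 1" "Z*(q^4*q^(2*k)) \<noteq> 1" "q^2 * q^(2*k) \<noteq> 1"
    unfolding Z power_add[symmetric] by (rule q(2); simp)+
  moreover have "Z \<noteq> q^(2*k)" "Z \<noteq> q^2 * q^(2*k)"
    unfolding Z power_add[symmetric] by (rule inj; presburger)+
  moreover have "q * Z \<noteq> q^(2*k)"
    using inj[of "Suc (2*N+1)" "2*k"] Suc.prems unfolding Z power_Suc by simp
  ultimately show ?case
    unfolding wp_prod_Suc e using Suc q(1) by (intro wp_ratio_shift) auto
qed


text \<open>The right-hand side is the difference of a Wilf-Zeilberger certificate relating the summands for
  \<open>Z\<close> and \<open>Z * q\<^sup>2\<close>.\<close>

lemma wp_sum_step: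
  fixes q Z w :: "'a::field"
  assumes A: "A * ((1 - Z) * (1 - Z * (q^2*w)) * (q * Z - w)) =
     B * ((1 - Z * q^2) * (1 - Z * (q*w)) * (Z - w))"
  and nz: "Z \<noteq> 1" "q * Z \<noteq> w" "Z * (q^2*w) \<noteq> 1"
  shows "(1 - q*Z) * (q * (1 - Z) * ((1 - q*w^2) * A) - (1 - Z*q^2) * ((1 - q*w^2) * B)) =
    (1 - Z*q^2) * (1 + q*Z) * (q * B * (1-w)^2 * (Z-w) / (q*Z-w) - B * (1-q*w)^2 * (1 - Z*(q*w)) / (1 - Z*(q^2*w)))"
proof -
  define X Y where "X = q*Z-w" and "Y = 1 - Z*(q^2*w)"
  have XY: "X \<noteq> 0" "Y \<noteq> 0" using nz by (auto simp: X_def Y_def)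
  have A': "(1 - Z) * A = B * ((1 - Z * q^2) * (1 - Z * (q*w)) * (Z - w)) / (X * Y)"
    using A XY unfolding X_def Y_def by (simp add: divide_simps mult_ac)
  \<comment> \<open>Over the common denominator \<open>X * Y\<close>, \<open>key\<close> is the
    numerator of the certificate difference and \<open>key2\<close> comes from the combination of
    \<open>A\<close> and \<open>B\<close>; both are multiples of
    \<open>w * (1-q) * (1-q*Z)\<close>.\<close>
  have key: "q * (1-w)^2 * (Z-w) * Y - (1-q*w)^2 * (1 - Z*(q*w)) * X = (1-q)*(1-q*Z)^2*w*(1-q*w^2)"
    unfolding X_def Y_def by (simp add: algebra_simps power2_eq_square)
  have key2: "q * ((1 - Z * (q*w)) * (Z - w)) - X * Y = w * (1-q) * (1-q*Z)*(1+q*Z)"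
    unfolding X_def Y_def by (simp add: algebra_simps power2_eq_square)
  have "(1 - q*Z) * (q * (1 - Z) * ((1 - q*w^2) * A) - (1 - Z*q^2) * ((1 - q*w^2) * B))
    = (1 - q*Z) * (1 - q*w^2) * (q * ((1 - Z) * A) - (1 - Z*q^2) * B)"
    by (simp add: algebra_simps)
  also have "\<dots> = (1 - q*Z) * (1 - q*w^2) * (1 - Z*q^2) * B * (q * ((1 - Z * (q*w)) * (Z - w)) - X * Y) / (X * Y)"
    unfolding A' using XY by (simp add: divide_simps) (simp add: algebra_simps)
  also have "\<dots> = (1 - Z*q^2) * (1 + q*Z) * B * ((1-q)*(1-q*Z)^2*w*(1-q*w^2)) / (X * Y)"
    unfolding key2 by (simp add: power2_eq_square mult_ac)
  also have "\<dots> = (1 - Z*q^2) * (1 + q*Z) * (q * B * (1-w)^2 * (Z-w) / X - B * (1-q*w)^2 * (1 - Z*(q*w)) / Y)"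
    unfolding key[symmetric] using XY by (simp add: divide_simps) (simp add: algebra_simps)
  finally show ?thesis unfolding X_def Y_def .
qed

text \<open>\<open>wp_sum_step\<close> telescopes over \<open>k\<close>. No lower boundary term
  appears, since the leading certificate part contains \<open>(1-w)^2\<close> and
  \<open>w = 1\<close> at \<open>k = 0\<close>.\<close>

lemma wp_partial_sum_shift:
  fixes q Z :: "'a::field"
  assumes q: "q \<noteq> 0" "\<And>i. i > 0 \<Longrightarrow> q ^ i \<noteq> 1" and Z: "Z = q ^ (2*N+1)" and "K \<le> N"
  shows "(1 - q*Z) * (q * (1 - Z) * (\<Sum>k\<le>K. (1 - q * (q^(2*k))^2) * wp_prod q (Z*q^2) k)
      - (1 - Z*q^2) * (\<Sum>k\<le>K. (1 - q * (q^(2*k))^2) * wp_prod q Z k))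
    = - (1 - Z*q^2) * (1 + q*Z) * (wp_prod q Z K * (1 - q*q^(2*K))^2 * (1 - Z*(q*q^(2*K))) / (1 - Z*(q^2*q^(2*K))))"
  using \<open>K \<le> N\<close>
proof (induction K)
  case 0
  have "1 - Z*q^2 \<noteq> 0" unfolding Z right_minus_eq power_add[symmetric] using q(2)[of "2*N+1+2"] by simp
  then show ?case by (simp add: wp_prod_def divide_simps) (simp add: algebra_simps power2_eq_square)
next
  case (Suc K)
  define v where "v = q^(2*K)"
  define w where "w = q^(2*Suc K)"
  have w: "w = q^2*v" unfolding v_def w_def by (simp add: power_add[symmetric])
  note inj = power_inj_if_no_root_of_unity[OF q]
  have nz: "1 - q*v \<noteq> 0" "1 - Z*(q*v) \<noteq> 0" "1 - q^2*v \<noteq> 0" "1 - Z*(q^2*v) \<noteq> 0" "Z \<noteq> 1"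
    unfolding right_minus_eq v_def Z power_add[symmetric] power_Suc[symmetric] by (rule q(2)[symmetric] q(2); simp)+
  have nz2: "Z * (q^2*w) \<noteq> 1"
    unfolding right_minus_eq w_def Z power_add[symmetric] power_Suc[symmetric] by (rule q(2); simp)
  have nz3: "Z - q*v \<noteq> 0" "Z - q^2*v \<noteq> 0" "q*Z \<noteq> w"
    unfolding right_minus_eq v_def w_def Z power_add[symmetric] power_Suc[symmetric] using Suc.prems
    by (intro inj; presburger)+
  define A B where "A = wp_prod q (Z*q^2) (Suc K)" and "B = wp_prod q Z (Suc K)"
  have AB: "A * ((1 - Z) * (1 - Z * (q^2*w)) * (q * Z - w)) = B * ((1 - Z * q^2) * (1 - Z * (q*w)) * (Z - w))"
    unfolding A_def B_def w_def by (rule wp_prod_shift[OF q Z Suc.prems])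
  have qz: "q*Z - w = q*(Z-q*v)" unfolding w by (simp add: algebra_simps power2_eq_square)
  \<comment> \<open>The trailing certificate part at \<open>K\<close> is the leading one at
    \<open>Suc K\<close>; this makes the sum telescope.\<close>
  have B: "wp_prod q Z K * (1 - q*v)^2 * (1 - Z*(q*v)) / (1 - Z*(q^2*v)) = q * B * (1-w)^2 * (Z-w) / (q*Z-w)"
    unfolding qz unfolding B_def wp_prod_Suc wp_ratio_def v_def[symmetric] w
    using nz nz3 q(1) by (simp add: divide_simps)
  have combine: "- c * d * X + c * d * (X - Y) = - c * d * Y" for c d X Y :: 'a
    by (simp add: algebra_simps)
  have "(1 - q*Z) * (q * (1 - Z) * (\<Sum>k\<le>Suc K. (1 - q * (q^(2*k))^2) * wp_prod q (Z*q^2) k)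
      - (1 - Z*q^2) * (\<Sum>k\<le>Suc K. (1 - q * (q^(2*k))^2) * wp_prod q Z k))
    = (1 - q*Z) * (q * (1 - Z) * (\<Sum>k\<le>K. (1 - q * (q^(2*k))^2) * wp_prod q (Z*q^2) k)
      - (1 - Z*q^2) * (\<Sum>k\<le>K. (1 - q * (q^(2*k))^2) * wp_prod q Z k))
    + (1 - q*Z) * (q * (1 - Z) * ((1 - q*w^2) * A) - (1 - Z*q^2) * ((1 - q*w^2) * B))"
    unfolding sum.atMost_Suc A_def B_def w_def by (simp only: algebra_simps)
  also have "\<dots> = - (1 - Z*q^2) * (1 + q*Z) * (B * (1-q*w)^2 * (1 - Z*(q*w)) / (1 - Z*(q^2*w)))"
    unfolding Suc.IH[OF Suc_leD[OF Suc.prems]] v_def[symmetric] B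
      wp_sum_step[OF AB nz(5) nz3(3) nz2] by (rule combine)
  finally show ?case unfolding B_def w_def .
qed


text \<open>A terminating 6-phi-5 summation, by induction on \<open>N\<close>. Going to
  \<open>Suc N\<close> replaces \<open>Z\<close> by \<open>Z*q^2\<close>, and
  \<open>wp_partial_sum_shift\<close> with the one new summand gives \<open>q * (1-Z)\<close> times
  the new sum = \<open>1 - Z*q^2\<close> times the old one.\<close>

lemma wp_sum:
  fixes q :: "'a::field"
  assumes q: "q \<noteq> 0" "\<And>i. i > 0 \<Longrightarrow> q ^ i \<noteq> 1"
  shows "q ^ N * (\<Sum>k\<le>N. (1 - q * (q^(2*k))^2) * wp_prod q (q ^ (2*N+1)) k) = 1 - q ^ (2*N+1)"
proof (induction N)
  case 0
  show ?case by (simp add: wp_prod_def)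
next
  case (Suc N)
  define Z w where "Z = q ^ (2*N+1)" and "w = q^(2*N)"
  have Zw: "Z = q * w" by (simp add: Z_def w_def)
  have Z': "q ^ (2 * Suc N + 1) = Z * q^2" by (simp add: Z_def power2_eq_square)
  have w': "q ^ (2 * Suc N) = q^2 * w" by (simp add: w_def power2_eq_square)
  define S S' where "S = (\<Sum>k\<le>N. (1 - q * (q^(2*k))^2) * wp_prod q Z k)"
    and "S' = (\<Sum>k\<le>N. (1 - q * (q^(2*k))^2) * wp_prod q (Z*q^2) k)"
  define A B where "A = wp_prod q (Z*q^2) N" and "B = wp_prod q Z N"
  have nz: "1 - q*w \<noteq> 0" "1 - q^2*w \<noteq> 0" "1 - q^3*w^2 \<noteq> 0" "1 - q^5*w^2 \<noteq> 0" "w \<noteq> 0" "q^2 \<noteq> 1"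
    unfolding right_minus_eq w_def power_mult[symmetric] power_add[symmetric] power_Suc[symmetric]
    by (rule q(2)[symmetric] q(2) power_not_zero[OF q(1)]; simp)+
  have "(1 + q) * (1 - q) \<noteq> 0"
    using nz(6) by (simp add: algebra_simps power2_eq_square)
  then have nz': "1 + q \<noteq> 0" "q \<noteq> 1"
    by auto
  have "A * (1 - q*w) * (1 - q^3*w^2) * (1 + q) * (w * (q-1)) =
      B * (1 - q^3*w) * ((1 - q*w)*(1+q*w)) * (w * (q-1))"
    using wp_prod_shift[OF q Z_def order.refl, folded A_def B_def w_def]
    unfolding Zw by (simp add: algebra_simps power2_eq_square power3_eq_cube)
  then have A: "A = B * (1 - q^3*w) * (1+q*w) / ((1 - q^3*w^2) * (1 + q))"
    using nz nz' by (simp add: divide_simps mult_ac)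
  have r: "wp_ratio q (Z*q^2) w = (1-q*w)^2 * (1 - q^4*w^2) * (1 + q) / ((1 - q^2*w)^2 * (1 - q^5*w^2) * q)"
  proof -
    have "wp_ratio q (Z*q^2) w = (1-q*w)^2 * (1 - q^4*w^2) * (1 + q) * (q*w * (q-1)) / ((1 - q^2*w)^2 * (1 - q^5*w^2) * q * (q*w * (q-1)))"
      unfolding wp_ratio_def Zw by (rule arg_cong2[where f="(/)"]) (simp_all add: algebra_simps power_numeral_reduce)
    then show ?thesis using nz nz' q(1) by simp
  qed
  \<comment> \<open>The summand \<open>k = Suc N\<close> of the new sum in terms of
    \<open>B\<close>; moved to the left side, it absorbs the boundary term of the telescoped
    identity.\<close>
  have last: "q * (1-q*w) * ((1 - q*(q^2*w)^2) * wp_prod q (Z*q^2) (Suc N)) =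
     B * (1 - q^2*w^2) * (1 - q^3*w) * (1-q*w)^2 * (1 + q^2*w) / ((1-q^3*w^2) * (1-q^2*w))"
  proof -
    have f: "1 - q*(q^2*w)^2 = 1 - q^5*w^2" "1 - q^4*w^2 = (1 - q^2*w)*(1+q^2*w)" "1 - q^2*w^2 = (1-q*w)*(1+q*w)"
      by (simp_all add: algebra_simps power_numeral_reduce)
    show ?thesis unfolding wp_prod_Suc A_def[symmetric] w_def[symmetric] r A f
      using nz nz' q(1) by (simp add: divide_simps power2_eq_square)
  qed
  have "(1 - q*Z) * (q * (1 - Z) * S' - (1 - Z*q^2) * S)
     = - (1 - Z*q^2) * (1 + q*Z) * (B * (1 - q*w)^2 * (1 - Z*(q*w)) / (1 - Z*(q^2*w)))"
    unfolding S_def S'_def B_def w_def by (rule wp_partial_sum_shift[OF q Z_def order.refl])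
  also have "\<dots> = - (1 - q*Z) * (q * (1-q*w) * ((1 - q*(q^2*w)^2) * wp_prod q (Z*q^2) (Suc N)))"
  proof -
    have f: "1 - Z*q^2 = 1 - q^3*w" "q*Z = q^2*w" "Z*(q*w) = q^2*w^2" "Z*(q^2*w) = q^3*w^2"
      unfolding Zw by (simp_all add: power_numeral_reduce)
    show ?thesis unfolding last f using nz by (simp add: divide_simps) (simp add: algebra_simps)
  qed
  finally have eq: "(1 - q*Z) * (q * (1 - Z) * S' - (1 - Z*q^2) * S) =
      - (1 - q*Z) * (q * (1 - Z) * ((1 - q*(q^2*w)^2) * wp_prod q (Z*q^2) (Suc N)))"
    unfolding Zw .
  have rearrange: "u * (t * (S' + L)) = u * (t' * S)" if "u * (t * S' - t' * S) = - u * (t * L)"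
    for u t t' S S' L :: 'a
    using that by (simp add: algebra_simps)
  have "(1 - q*Z) * (q * (1 - Z) * (S' + (1 - q*(q^2*w)^2) * wp_prod q (Z*q^2) (Suc N)))
      = (1 - q*Z) * ((1 - Z*q^2) * S)"
    by (rule rearrange[OF eq])
  moreover have "1 - q*Z \<noteq> 0" using nz unfolding Zw by (simp add: power2_eq_square mult_ac)
  ultimately have "(1 - Z) * (q * (S' + (1 - q*(q^2*w)^2) * wp_prod q (Z*q^2) (Suc N))) = (1 - Z*q^2) * S"
    by (simp add: mult_ac)
  then have "(1 - Z) * (q ^ Suc N * (S' + (1 - q*(q^2*w)^2) * wp_prod q (Z*q^2) (Suc N))) = (1 - Z*q^2) * (q^N * S)"
    by (simp add: mult_ac)
  also have "q ^ N * S = 1 - Z" using Suc.IH by (simp only: S_def Z_def)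
  finally have "q ^ Suc N * (S' + (1 - q*(q^2*w)^2) * wp_prod q (Z*q^2) (Suc N)) = 1 - Z*q^2"
    using nz(1) unfolding Zw by (simp add: mult.assoc)
  then show ?case unfolding sum.atMost_Suc Z' w' S'_def .
qed

subsection \<open>Rational functions at a point\<close>

text \<open>The fraction need not be in lowest terms, so closure under arithmetic requires no
  cancellation of common factors.\<close>

definition has_value :: "complex \<Rightarrow> complex poly fract \<Rightarrow> complex \<Rightarrow> bool" where
  "has_value z A v \<longleftrightarrow>
     (\<exists>U V. poly V z \<noteq> 0 \<and> A = to_fract U / to_fract V \<and> v = poly U z / poly V z)"

lemma has_value_to_fract: "has_value z (to_fract U) (poly U z)"
  unfolding has_value_def by (rule exI[of _ U], rule exI[of _ 1]) simp

lemma has_value_0: "has_value z 0 0"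
  using has_value_to_fract[of z 0] by simp

lemma has_value_1: "has_value z 1 1"
  using has_value_to_fract[of z 1] by simp

lemma has_value_indet: "has_value z (to_fract indet) z"
  using has_value_to_fract[of z indet] by (simp add: indet_def)

lemma has_value_add:
  assumes "has_value z A v" "has_value z B w"
  shows "has_value z (A + B) (v + w)"
proof -
  obtain U V U' V' where *: "poly V z \<noteq> 0" "A = to_fract U / to_fract V" "v = poly U z / poly V z"
    "poly V' z \<noteq> 0" "B = to_fract U' / to_fract V'" "w = poly U' z / poly V' z"
    using assms unfolding has_value_def by blast
  then have "V \<noteq> 0" "V' \<noteq> 0" by auto
  with * show ?thesis unfolding has_value_def
    by (intro exI[of _ "U * V' + U' * V"] exI[of _ "V * V'"]) (simp add: add_frac_eq)
qed

lemma has_value_mult: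
  assumes "has_value z A v" "has_value z B w"
  shows "has_value z (A * B) (v * w)"
proof -
  obtain U V U' V' where *: "poly V z \<noteq> 0" "A = to_fract U / to_fract V" "v = poly U z / poly V z"
    "poly V' z \<noteq> 0" "B = to_fract U' / to_fract V'" "w = poly U' z / poly V' z"
    using assms unfolding has_value_def by blast
  then show ?thesis unfolding has_value_def
    by (intro exI[of _ "U * U'"] exI[of _ "V * V'"]) simp
qed

lemma has_value_uminus: "has_value z A v \<Longrightarrow> has_value z (- A) (- v)"
  using has_value_mult[OF has_value_to_fract[of z "-1"], of A v] by simp

lemma has_value_diff: "has_value z A v \<Longrightarrow> has_value z B w \<Longrightarrow> has_value z (A - B) (v - w)"
  using has_value_add[OF _ has_value_uminus, of z A v B w] by simp

lemma has_value_inverse: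
  assumes "has_value z A v" "v \<noteq> 0"
  shows "has_value z (inverse A) (inverse v)"
proof -
  obtain U V where *: "poly V z \<noteq> 0" "A = to_fract U / to_fract V" "v = poly U z / poly V z"
    using assms unfolding has_value_def by blast
  with assms(2) show ?thesis unfolding has_value_def
    by (intro exI[of _ V] exI[of _ U]) simp
qed

lemma has_value_divide:
  "has_value z A v \<Longrightarrow> has_value z B w \<Longrightarrow> w \<noteq> 0 \<Longrightarrow> has_value z (A / B) (v / w)"
  unfolding divide_inverse by (intro has_value_mult has_value_inverse)

lemma has_value_power: "has_value z A v \<Longrightarrow> has_value z (A ^ k) (v ^ k)"
  by (induction k) (auto intro: has_value_1 has_value_mult)

lemma has_value_sum:
  "(\<And>i. i \<in> I \<Longrightarrow> has_value z (f i) (g i)) \<Longrightarrow> has_value z (sum f I) (sum g I)"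
  by (induction I rule: infinite_finite_induct) (auto intro: has_value_0 has_value_add)

lemma has_value_prod:
  "(\<And>i. i \<in> I \<Longrightarrow> has_value z (f i) (g i)) \<Longrightarrow> has_value z (prod f I) (prod g I)"
  by (induction I rule: infinite_finite_induct) (auto intro: has_value_1 has_value_mult)

lemmas has_value_intros = has_value_0 has_value_1 has_value_indet has_value_add has_value_diff
  has_value_mult has_value_divide has_value_power has_value_sum has_value_prod

lemma has_value_nonzero: "has_value z A v \<Longrightarrow> v \<noteq> 0 \<Longrightarrow> A \<noteq> 0"
  unfolding has_value_def by auto

text \<open>A zero of order at least \<open>e\<close>: the cofactor is regular but may itself vanish
  at \<open>z\<close>. For \<open>e = 0\<close> this is regularity.\<close>

definition vanishes :: "complex \<Rightarrow> nat \<Rightarrow> complex poly fract \<Rightarrow> bool" where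
  "vanishes z e A \<longleftrightarrow> (\<exists>B v. has_value z B v \<and> A = to_fract [:- z, 1:] ^ e * B)"

lemma vanishesI: "has_value z B v \<Longrightarrow> A = to_fract [:- z, 1:] ^ e * B \<Longrightarrow> vanishes z e A"
  unfolding vanishes_def by blast

lemma vanishes_0_iff: "vanishes z 0 A \<longleftrightarrow> (\<exists>v. has_value z A v)"
  by (auto simp: vanishes_def)

lemma vanishes_1_if_value_0:
  assumes "has_value z A 0"
  shows "vanishes z 1 A"
proof -
  obtain U V where *: "poly V z \<noteq> 0" "A = to_fract U / to_fract V" "poly U z = 0"
    using assms unfolding has_value_def by auto
  obtain W where "U = [:- z, 1:] * W" using *(3) unfolding poly_eq_0_iff_dvd by blast
  moreover have "has_value z (to_fract W / to_fract V) (poly W z / poly V z)"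
    using * by (intro has_value_divide has_value_to_fract)
  ultimately show ?thesis using * by (intro vanishesI) (auto simp del: mult_pCons_left)
qed

lemma vanishes_zero: "vanishes z e 0"
  by (rule vanishesI[OF has_value_0]) simp

lemma vanishes_add:
  assumes "vanishes z e A" "vanishes z e B"
  shows "vanishes z e (A + B)"
  using assms unfolding vanishes_def
  by (metis has_value_add distrib_left)

lemma vanishes_mult:
  assumes "vanishes z e A" "vanishes z e' B"
  shows "vanishes z (e + e') (A * B)"
proof -
  obtain A' v B' w where "has_value z A' v" "A = to_fract [:- z, 1:] ^ e * A'"
    "has_value z B' w" "B = to_fract [:- z, 1:] ^ e' * B'"
    using assms unfolding vanishes_def by blast
  then show ?thesis by (intro vanishesI[OF has_value_mult]) (auto simp: power_add)
qed

lemma vanishes_mult_regular: "vanishes z e A \<Longrightarrow> has_value z B v \<Longrightarrow> vanishes z e (A * B)"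
  using vanishes_mult[of z e A 0 B] by (auto simp: vanishes_0_iff)

lemma vanishes_uminus: "vanishes z e A \<Longrightarrow> vanishes z e (- A)"
  using vanishes_mult_regular[OF _ has_value_to_fract[of z "-1"], of e A] by simp

lemma vanishes_diff: "vanishes z e A \<Longrightarrow> vanishes z e B \<Longrightarrow> vanishes z e (A - B)"
  using vanishes_add[OF _ vanishes_uminus, of z e A B] by simp

lemma vanishes_power: "vanishes z e A \<Longrightarrow> vanishes z (k * e) (A ^ k)"
  by (induction k) (auto simp: vanishes_0_iff intro: has_value_1 vanishes_mult)

lemma vanishes_sum: "(\<And>i. i \<in> I \<Longrightarrow> vanishes z e (f i)) \<Longrightarrow> vanishes z e (sum f I)"
  by (induction I rule: infinite_finite_induct) (auto intro: vanishes_zero vanishes_add)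

lemma vanishes_mono:
  assumes "vanishes z e A" "e' \<le> e"
  shows "vanishes z e' A"
proof -
  obtain B v where B: "has_value z B v" "A = to_fract [:- z, 1:] ^ e * B"
    using assms(1) unfolding vanishes_def by blast
  have "has_value z (to_fract [:- z, 1:] ^ (e - e') * B) (poly [:- z, 1:] z ^ (e - e') * v)"
    by (intro has_value_mult has_value_power has_value_to_fract B)
  then show ?thesis using B(2) assms(2)
    by (rule_tac vanishesI) (auto simp: power_add[symmetric] mult.assoc[symmetric])
qed

section \<open>From orders of vanishing to a congruence\<close>

lemma coprime_linear_iff:
  fixes V :: "complex poly"
  shows "coprime [:- z, 1:] V \<longleftrightarrow> poly V z \<noteq> 0"
proof
  assume "coprime [:- z, 1:] V"
  then show "poly V z \<noteq> 0" unfolding poly_eq_0_iff_dvd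
    using coprime_common_divisor[of "[:- z, 1:]" V "[:- z, 1:]"] by (auto simp: is_unit_poly_iff)
next
  have "prime_elem [:- z, 1:]" by (rule prime_elem_linear_field_poly) simp
  moreover assume "poly V z \<noteq> 0"
  ultimately show "coprime [:- z, 1:] V" unfolding poly_eq_0_iff_dvd
    by (rule prime_elem_imp_coprime)
qed

lemma fract_reduced_form:
  fixes A :: "complex poly fract"
  obtains U V where "A = to_fract U / to_fract V" "V \<noteq> 0" "coprime U V"
proof
  show "A = to_fract (fst (quot_of_fract A)) / to_fract (snd (quot_of_fract A))"
    by (simp flip: Fract_conv_to_fract)
  show "snd (quot_of_fract A) \<noteq> 0" by simp
  show "coprime (fst (quot_of_fract A)) (snd (quot_of_fract A))"
    by (rule coprime_quot_of_fract)
qed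

text \<open>\<open>vanishes\<close> supplies a denominator depending on \<open>z\<close>, whereas
  \<open>ratfun_cong\<close> asks for one that suits all roots. The reduced denominator
  \<open>V\<close> divides each local denominator \<open>V'\<close>, so it is nonzero at each such
  \<open>z\<close>.\<close>

lemma vanishes_reduced_form:
  fixes U V :: "complex poly"
  assumes "vanishes z e (to_fract U / to_fract V)" "V \<noteq> 0" "coprime U V"
  shows "poly V z \<noteq> 0" "[:- z, 1:] ^ e dvd U"
proof -
  obtain U' V' where V': "poly V' z \<noteq> 0"
    and eq: "to_fract U / to_fract V = to_fract [:- z, 1:] ^ e * (to_fract U' / to_fract V')"
    using assms(1) unfolding vanishes_def has_value_def by blast
  have pow: "to_fract [:- z, 1:] ^ e = to_fract ([:- z, 1:] ^ e)"
    by (induction e) (simp_all del: mult_pCons_left)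
  have "V' \<noteq> 0" using V' by auto
  then have "to_fract (U * V') = to_fract ([:- z, 1:] ^ e * U' * V)"
    using eq assms(2) unfolding pow to_fract_mult by (simp add: divide_simps mult_ac)
  then have eq': "U * V' = [:- z, 1:] ^ e * U' * V" unfolding to_fract_eq_iff .
  have "V dvd U * V'" unfolding eq' by simp
  then have "V dvd V'" using assms(3) by (metis coprime_commute coprime_dvd_mult_right_iff)
  then show "poly V z \<noteq> 0" using V' by auto
  have "[:- z, 1:] ^ e dvd U * V'" unfolding eq' by (simp add: mult.assoc)
  moreover have "coprime ([:- z, 1:] ^ e) V'" using V' by (simp add: coprime_linear_iff)
  ultimately show "[:- z, 1:] ^ e dvd U" by (simp add: coprime_dvd_mult_left_iff)
qed

lemma prod_coprime_dvd:
  fixes f :: "'b \<Rightarrow> 'a::semiring_gcd"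
  assumes "finite I" "\<And>i. i \<in> I \<Longrightarrow> f i dvd a"
    "\<And>i j. i \<in> I \<Longrightarrow> j \<in> I \<Longrightarrow> i \<noteq> j \<Longrightarrow> coprime (f i) (f j)"
  shows "prod f I dvd a"
  using assms by (induction I rule: finite_induct) (auto intro!: divides_mult prod_coprime_right)

text \<open>Linear factors at distinct roots are coprime, so if each power divides the reduced
  numerator, so does their product.\<close>

lemma ratfun_cong_if_vanishes:
  assumes "finite I" "inj_on r I" "\<And>i. i \<in> I \<Longrightarrow> vanishes (r i) (e i) (A - B)"
  shows "ratfun_cong A B (\<Prod>i\<in>I. [:- r i, 1:] ^ e i)"
proof -
  obtain U V where UV: "A - B = to_fract U / to_fract V" "V \<noteq> 0" "coprime U V"
    by (rule fract_reduced_form)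
  have loc: "poly V (r i) \<noteq> 0" "[:- r i, 1:] ^ e i dvd U" if "i \<in> I" for i
    using vanishes_reduced_form[OF _ UV(2,3)] assms(3)[OF that] unfolding UV(1) by blast+
  have "coprime ([:- r i, 1:] ^ e i) ([:- r j, 1:] ^ e j)" if "i \<in> I" "j \<in> I" "i \<noteq> j" for i j
    using inj_onD[OF assms(2)] that
    by (intro coprime_power_left_iff[THEN iffD2] coprime_power_right_iff[THEN iffD2] disjI1)
       (auto simp: coprime_linear_iff)
  then have "(\<Prod>i\<in>I. [:- r i, 1:] ^ e i) dvd U"
    by (intro prod_coprime_dvd assms(1) loc)
  then obtain W where W: "U = (\<Prod>i\<in>I. [:- r i, 1:] ^ e i) * W" by blast
  have "coprime V (\<Prod>i\<in>I. [:- r i, 1:] ^ e i)"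
    using loc(1) by (subst coprime_commute, intro prod_coprime_left) (simp add: coprime_linear_iff)
  then show ?thesis unfolding ratfun_cong_def UV(1) W using UV(2)
    by (intro exI[of _ W] exI[of _ V]) simp
qed

subsection \<open>The terms at a root of unity\<close>

definition qratio :: "'a::field \<Rightarrow> nat \<Rightarrow> 'a" where
  "qratio q i = (1 - q ^ (2*i+1)) / (1 - q ^ (2*i+2))"

text \<open>With \<open>x = q^j \<noteq> 1\<close> and \<open>y = (1-Z)^2 / Z\<close>, one has
  \<open>(1 - Z*x) * (Z - x) = Z * (1-x)^2 * (1 - y * lsq q j)\<close>.\<close>

definition lsq :: "'a::field \<Rightarrow> nat \<Rightarrow> 'a" where
  "lsq q j = q ^ j / (1 - q ^ j)^2"

text \<open>To first order in \<open>y\<close>, the perturbation factor of \<open>c q k\<close> is \<open>1 + y * dlog q k\<close>.\<close>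

definition dlog :: "'a::field \<Rightarrow> nat \<Rightarrow> 'a" where
  "dlog q k = (\<Sum>i<k. lsq q (2*i+2) - lsq q (2*i+1))"

lemma c_eq_qratio: "c q k = qint q (4*k+1) * (\<Prod>i<k. qratio q i) ^ 4"
proof -
  have "q * (q^2)^i = q ^ (2*i+1)" "q^2 * (q^2)^i = q ^ (2*i+2)" for i
    by (simp_all add: power_mult power2_eq_square)
  then show ?thesis
    unfolding c_def qpoch_def qratio_def prod_dividef by (simp only: power_divide times_divide_eq_right)
qed

lemma one_minus_times_qint: "(1 - q) * qint q m = 1 - q ^ m" for q :: "'a::comm_ring_1"
  unfolding qint_def by (rule one_diff_power_eq[symmetric])

section \<open>Reflection symmetry of the terms\<close>

lemma sum_antisymmetric_eq_0:
  fixes f :: "nat \<Rightarrow> 'a::field_char_0"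
  assumes "\<And>k. k \<le> N \<Longrightarrow> f (N - k) = - f k"
  shows "(\<Sum>k\<le>N. f k) = 0"
proof -
  have "(\<Sum>k\<le>N. f k) = (\<Sum>k\<le>N. f (N - k))"
    by (rule sum.reindex_bij_witness[of _ "\<lambda>k. N - k" "\<lambda>k. N - k"]) auto
  also have "\<dots> = - (\<Sum>k\<le>N. f k)"
    using assms by (simp add: sum_negf)
  finally show ?thesis by (simp add: equal_neg_zero)
qed

lemma power_diff_order:
  fixes z :: "'a::field"
  assumes "z ^ n = 1" "n > 0" "j \<le> n"
  shows "z ^ (n - j) = 1 / z ^ j"
proof -
  have "z \<noteq> 0" using assms by (auto simp: power_0_left)
  then show ?thesis using assms by (simp add: power_diff)
qed

text \<open>Modulo \<open>2*N+1\<close> the exponents at \<open>N - Suc i\<close> are the negatives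
  of those at \<open>i\<close>, with odd and even exchanged. Thus numerator and denominator swap,
  and \<open>1 - 1/x = - (1-x)/x\<close> leaves a single power of \<open>z\<close>.\<close>

lemma qratio_reflect:
  fixes z :: "'a::field"
  assumes z: "\<And>j. z ^ j = 1 \<longleftrightarrow> 2*N+1 dvd j" and "i < N"
  shows "qratio z (N - Suc i) * qratio z i * z = 1"
proof -
  have n: "z ^ (2*N+1) = 1" by (simp only: z dvd_refl)
  have z0: "z \<noteq> 0" using n by (auto simp: power_0_left)
  have e: "2 * (N - Suc i) + 1 = 2*N+1 - (2*i+2)" "2 * (N - Suc i) + 2 = 2*N+1 - (2*i+1)"
    using \<open>i < N\<close> by auto
  have nz: "z ^ (2*i+1) \<noteq> 1" "z ^ (2*i+2) \<noteq> 1"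
    unfolding z using \<open>i < N\<close> by (auto dest!: dvd_imp_le)
  have "qratio z (N - Suc i) = (1 - 1 / z ^ (2*i+2)) / (1 - 1 / z ^ (2*i+1))"
    unfolding qratio_def e using \<open>i < N\<close> by (subst (1 2) power_diff_order[OF n]) auto
  also have "\<dots> = (z ^ (2*i+2) - 1) / ((z ^ (2*i+1) - 1) * z)"
    using nz z0 by (simp add: divide_simps)
  finally have eq: "qratio z (N - Suc i) = (z ^ (2*i+2) - 1) / ((z ^ (2*i+1) - 1) * z)" .
  show ?thesis unfolding eq unfolding qratio_def using nz z0
    by (simp add: divide_simps) (simp add: algebra_simps)
qed

lemma qratio_prod_reflect:
  fixes z :: "'a::field"
  assumes z: "\<And>j. z ^ j = 1 \<longleftrightarrow> 2*N+1 dvd j" and "k \<le> N"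
  shows "(\<Prod>i<N - k. qratio z i) ^ 4 = z ^ (4*k+1) * (\<Prod>i<k. qratio z i) ^ 4"
  using \<open>k \<le> N\<close>
proof (induction k)
  case 0
  have n: "z ^ (2*N) * z = 1" using z[of "2*N+1"] by (simp add: mult.commute)
  let ?P = "\<Prod>i<N. qratio z i"
  \<comment> \<open>Pairing \<open>i\<close> with \<open>N - Suc i\<close> in the full product gives
    \<open>?P^2 * z^N = 1\<close>; squaring and \<open>z^(2*N) * z = 1\<close> give
    \<open>?P^4 = z\<close>.\<close>
  have "1 = (\<Prod>i<N. qratio z (N - Suc i) * qratio z i * z)"
    using qratio_reflect[OF z] by simp
  also have "\<dots> = ?P * ?P * z ^ N"
    by (simp add: prod.distrib prod.nat_diff_reindex)
  finally have "(?P * ?P * z ^ N) ^ 2 = 1" by simp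
  moreover have "(?P * ?P * z ^ N) ^ 2 = ?P ^ 4 * z ^ (2*N)"
    unfolding mult_2 power_add by (simp add: power4_eq_xxxx power2_eq_square mult_ac)
  ultimately have "?P ^ 4 * z ^ (2*N) = z ^ (2*N) * z" by (simp only: n)
  moreover have "z ^ (2*N) \<noteq> 0" using n by auto
  ultimately have "?P ^ 4 = z" by (metis mult.commute mult_left_cancel)
  then show ?case by simp
next
  case (Suc k)
  define r where "r = qratio z (N - Suc k)"
  have rk: "r * qratio z k * z = 1"
    unfolding r_def using Suc.prems by (intro qratio_reflect[OF z]) auto
  have N: "N - k = Suc (N - Suc k)" using Suc.prems by simp
  have "(\<Prod>i<N - Suc k. qratio z i) ^ 4 * r ^ 4 = (\<Prod>i<N - k. qratio z i) ^ 4"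
    unfolding N by (simp add: r_def power_mult_distrib)
  also have "\<dots> = z ^ (4*k+1) * (\<Prod>i<k. qratio z i) ^ 4" using Suc by simp
  finally have "(\<Prod>i<N - Suc k. qratio z i) ^ 4 * (r * qratio z k * z) ^ 4
      = z ^ (4*k+1) * (\<Prod>i<k. qratio z i) ^ 4 * (qratio z k * z) ^ 4"
    by (simp add: power_mult_distrib mult_ac)
  moreover have "4 * Suc k + 1 = 4 * k + 1 + 4" by simp
  then have "z ^ (4 * Suc k + 1) = z ^ (4*k+1) * z ^ 4" by (simp only: power_add)
  ultimately show ?case unfolding rk by (simp add: power_mult_distrib mult_ac)
qed

text \<open>The exponents \<open>4*(N-k)+1\<close> and \<open>4*k+1\<close> add up to
  \<open>2*(2*N+1)\<close>, so the two q-integers differ by the factor \<open>- z^(4*k+1)\<close>.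
  Its power of \<open>z\<close> cancels against \<open>qratio_prod_reflect\<close>; the sign
  remains.\<close>

lemma c_reflect:
  fixes z :: "'a::field"
  assumes z: "\<And>j. z ^ j = 1 \<longleftrightarrow> 2*N+1 dvd j" and "N > 0" "k \<le> N"
  shows "c z (N - k) = - c z k"
proof -
  have "z \<noteq> 1" using z[of 1] \<open>N > 0\<close> by auto
  have "4 * (N - k) + 1 + (4*k+1) = (2*N+1) * 2" using \<open>k \<le> N\<close> by simp
  then have "z ^ (4 * (N - k) + 1 + (4*k+1)) = 1" unfolding z by (metis dvd_triv_left)
  then have inv: "z ^ (4*k+1) * z ^ (4 * (N - k) + 1) = 1" by (simp only: power_add mult.commute)
  have "(1 - z) * (z ^ (4*k+1) * qint z (4 * (N - k) + 1)) = z ^ (4*k+1) * (1 - z ^ (4 * (N - k) + 1))"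
    unfolding one_minus_times_qint[symmetric] by (rule mult.left_commute)
  also have "\<dots> = - (1 - z ^ (4*k+1))" unfolding right_diff_distrib inv by simp
  also have "\<dots> = (1 - z) * - qint z (4*k+1)"
    unfolding one_minus_times_qint[symmetric] by (rule minus_mult_right)
  finally have "(1 - z) * (z ^ (4*k+1) * qint z (4 * (N - k) + 1)) = (1 - z) * - qint z (4*k+1)" .
  then have "z ^ (4*k+1) * qint z (4 * (N - k) + 1) = - qint z (4*k+1)"
    using \<open>z \<noteq> 1\<close> unfolding mult_cancel_left by simp
  then show ?thesis
    unfolding c_eq_qratio qratio_prod_reflect[OF z \<open>k \<le> N\<close>]
    by (simp only: mult.left_commute mult.assoc[symmetric] mult_minus_left)
qed

text \<open>\<open>lsq\<close> is unchanged when \<open>z^j\<close> is inverted, and reflection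
  exchanges odd and even exponents, so the summands of \<open>dlog\<close> are antisymmetric. Hence
  the full sum up to \<open>N\<close> is 0 and the partial sums are symmetric.\<close>

lemma dlog_reflect:
  fixes z :: "'a::field_char_0"
  assumes z: "\<And>j. z ^ j = 1 \<longleftrightarrow> 2*N+1 dvd j" and "k \<le> N"
  shows "dlog z (N - k) = dlog z k"
proof -
  have n: "z ^ (2*N+1) = 1" by (simp only: z dvd_refl)
  have z0: "z \<noteq> 0" using n by (auto simp: power_0_left)
  have lsq: "lsq z (2*N+1 - j) = lsq z j" if "0 < j" "j < 2*N+1" for j
  proof -
    have "z ^ j \<noteq> 1" unfolding z using that by (auto dest: dvd_imp_le)
    moreover have pd: "z ^ (2*N+1 - j) = 1 / z ^ j"
      using that by (intro power_diff_order n) auto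
    moreover have "1 - 1 / z ^ j = - (1 - z ^ j) / z ^ j"
      using z0 by (simp add: divide_simps)
    ultimately show ?thesis using z0 unfolding lsq_def pd
      by (simp add: power_divide power2_eq_square) (simp add: algebra_simps)
  qed
  define t where "t i = lsq z (2*i+2) - lsq z (2*i+1)" for i
  have t: "t (N - Suc i) = - t i" if "i < N" for i
  proof -
    have e: "2 * (N - Suc i) + 1 = 2*N+1 - (2*i+2)" "2 * (N - Suc i) + 2 = 2*N+1 - (2*i+1)"
      using that by auto
    show ?thesis unfolding t_def e using that by (subst (1 2) lsq) auto
  qed
  show ?thesis using \<open>k \<le> N\<close>
  proof (induction k)
    case 0
    have "dlog z N = (\<Sum>i<N. t (N - Suc i))"
      unfolding dlog_def sum.nat_diff_reindex by (simp add: t_def)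
    also have "\<dots> = (\<Sum>i<N. - t i)" using t by (intro sum.cong) auto
    also have "\<dots> = - dlog z N" unfolding sum_negf dlog_def t_def ..
    finally have "dlog z N = 0" by (simp add: equal_neg_zero)
    then show ?case by (simp add: dlog_def)
  next
    case (Suc k)
    have N: "N - k = Suc (N - Suc k)" using Suc.prems by simp
    have "dlog z (N - k) = dlog z (N - Suc k) + t (N - Suc k)"
      unfolding N dlog_def t_def by simp
    moreover have "dlog z (Suc k) = dlog z k + t k" by (simp add: dlog_def t_def)
    ultimately show ?case using Suc t[of k] by simp
  qed
qed

lemma c_sum_eq_0:
  fixes z :: "'a::field_char_0"
  assumes "\<And>j. z ^ j = 1 \<longleftrightarrow> 2*N+1 dvd j" "N > 0"
  shows "(\<Sum>k\<le>N. c z k) = 0" "(\<Sum>k\<le>N. c z k * dlog z k) = 0"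
  using c_reflect[OF assms] dlog_reflect[OF assms(1)] by (auto intro!: sum_antisymmetric_eq_0)

text \<open>The factor \<open>qratio z N\<close> is 0 by its numerator, and division by zero
  elsewhere only yields further zeros. From \<open>k = 2*N+1\<close> on, this need not be the value
  of \<open>c Q k\<close> at \<open>z\<close>.\<close>

lemma c_eq_0:
  fixes z :: "'a::field"
  assumes "z ^ (2*N+1) = 1" "N < k"
  shows "c z k = 0"
proof -
  have "(\<Prod>i<k. qratio z i) = 0" using assms
    by (intro prod_zero) (auto simp: qratio_def intro!: bexI[of _ N])
  then show ?thesis by (simp add: c_eq_qratio)
qed

section \<open>Triangular double sums and blocks of indices\<close>

lemma double_sum_eq_if_sum:
  fixes f :: "nat \<Rightarrow> nat \<Rightarrow> 'a::comm_monoid_add"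
  shows "(\<Sum>k<n. \<Sum>j\<le>k. f j (k - j)) = (\<Sum>i<n. \<Sum>j<n. if i + j < n then f i j else 0)"
proof -
  have "(\<Sum>k<n. \<Sum>j\<le>k. f j (k - j)) = (\<Sum>(i, j)\<in>{(i, j). i + j < n}. f i j)"
    by (rule sum.triangle_reindex[symmetric])
  also have "\<dots> = (\<Sum>(i, j)\<in>{..<n} \<times> {..<n}. if i + j < n then f i j else 0)"
    by (rule sum.mono_neutral_cong_left) (auto split: if_splits)
  finally show ?thesis by (simp add: sum.cartesian_product)
qed

lemma prod_lessThan_add: "(\<Prod>i<m+n. f i) = (\<Prod>i<m. f i) * (\<Prod>i<n. f (m+i))"
  for f :: "nat \<Rightarrow> 'a::comm_monoid_mult"
  by (induction n) (simp_all add: mult.assoc)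

lemma sum_blocks: "(\<Sum>i<m*d. f i) = (\<Sum>a<m. \<Sum>b<d. f (a*d+b))" for f :: "nat \<Rightarrow> 'a::comm_monoid_add"
proof -
  have "(\<Sum>i<m*d. f i) = (\<Sum>a<m. sum f {a*d..<a*d+d})" by (rule sum.nat_group[symmetric])
  moreover have "sum f {a*d..<a*d+d} = (\<Sum>b<d. f (a*d+b))" for a
    by (rule sum.reindex_bij_witness[of _ "\<lambda>b. a*d+b" "\<lambda>i. i - a*d"]) auto
  ultimately show ?thesis by simp
qed

text \<open>\<open>u\<close> lives on offsets \<open>b \<le> M\<close> with \<open>2*M < d\<close>,
  so adding two such indices never carries into the next block, and the triangle condition depends
  only on \<open>a + a'\<close>. The inner sums then factor out as
  \<open>(\<Sum>b<d. u b) = 0\<close>.\<close>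

lemma double_sum_blocks_eq_0:
  fixes C W u :: "nat \<Rightarrow> 'a::comm_ring_1"
  assumes C: "\<And>a b. b < d \<Longrightarrow> C (a*d+b) = W a * u b"
    and u: "\<And>b. M < b \<Longrightarrow> u b = 0" "(\<Sum>b\<le>M. u b) = 0" and d: "d = 2*M+1"
  shows "(\<Sum>k<m*d. \<Sum>j\<le>k. C j * C (k - j)) = 0"
proof -
  have u0: "(\<Sum>b<d. u b) = 0"
    using u d by (subst sum.mono_neutral_right[of _ "{..M}"]) auto
  have "(if a*d+b + (a'*d+b') < m*d then C (a*d+b) * C (a'*d+b') else 0)
      = (if a + a' < m then W a * W a' else 0) * u b * u b'" if "b < d" "b' < d" for a a' b b'
  proof (cases "b \<le> M \<and> b' \<le> M")
    case True
    then have lt: "b + b' < d" using d by simp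
    have "(a + a') * d + (b + b') < m*d \<longleftrightarrow> a + a' < m"
    proof
      assume "(a + a') * d + (b + b') < m*d"
      then have "(a + a') * d < m * d" by linarith
      then show "a + a' < m" by simp
    next
      assume "a + a' < m"
      then have "Suc (a + a') * d \<le> m * d" by (intro mult_le_mono1) simp
      then show "(a + a') * d + (b + b') < m*d" using lt by simp
    qed
    then have "a*d+b + (a'*d+b') < m*d \<longleftrightarrow> a + a' < m"
      by (simp add: algebra_simps)
    then show ?thesis using that by (simp add: C mult_ac)
  next
    case False
    then have "u b = 0 \<or> u b' = 0" using u(1) by (auto simp: not_le)
    then show ?thesis using that by (auto simp: C)
  qed
  then have "(\<Sum>k<m*d. \<Sum>j\<le>k. C j * C (k - j)) =
      (\<Sum>a<m. \<Sum>b<d. \<Sum>a'<m. \<Sum>b'<d. (if a + a' < m then W a * W a' else 0) * u b * u b')"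
    unfolding double_sum_eq_if_sum[of "\<lambda>i j. C i * C j"] sum_blocks by (intro sum.cong refl) auto
  also have "\<dots> = 0" by (simp add: sum_distrib_left[symmetric] u0)
  finally show ?thesis .
qed

subsection \<open>Order of vanishing of the sums at a root of unity\<close>

abbreviation Q :: "complex poly fract" where "Q \<equiv> to_fract indet"

lemma indet_power: "Q ^ i = to_fract (indet ^ i)"
  by (induction i) simp_all

lemma indet_nonzero: "Q \<noteq> 0"
  by (simp add: indet_def)

lemma indet_power_neq_1: "i > 0 \<Longrightarrow> Q ^ i \<noteq> 1"
proof
  assume "i > 0" "Q ^ i = 1"
  then have "indet ^ i = 1" unfolding indet_power using to_fract_eq_iff by fastforce
  then have "poly (indet ^ i) 0 = 1" by simp
  then show False using \<open>i > 0\<close> by (simp add: indet_def power_0_left)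
qed

lemma has_value_qint: "has_value z (qint Q m) (qint z m)"
  unfolding qint_def by (intro has_value_intros)

lemma has_value_qratio:
  assumes "z ^ (2*i+2) \<noteq> 1"
  shows "has_value z (qratio Q i) (qratio z i)"
  unfolding qratio_def using assms by (intro has_value_intros) auto

lemma has_value_lsq:
  assumes "z ^ j \<noteq> 1"
  shows "has_value z (lsq Q j) (lsq z j)"
  unfolding lsq_def using assms by (intro has_value_intros) auto

lemma power_add_period:
  fixes z :: "'a::monoid_mult"
  assumes "z ^ d = 1"
  shows "z ^ (k*d + i) = z ^ i"
proof -
  have "z ^ (d*k + i) = z ^ i" unfolding power_add power_mult assms by simp
  then show ?thesis by (simp only: mult.commute)
qed

text \<open>Used with \<open>j = 2*i+2\<close>, which is even and so differs from the odd
  order.\<close>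

lemma odd_order_power_neq_1:
  fixes z :: "'a::monoid_mult"
  assumes "\<And>j. z ^ j = 1 \<longleftrightarrow> 2*N+1 dvd j" "0 < j" "j < 2*(2*N+1)" "j \<noteq> 2*N+1"
  shows "z ^ j \<noteq> 1"
proof
  assume "z ^ j = 1"
  then obtain r where r: "j = (2*N+1) * r" unfolding assms(1) by (elim dvdE)
  then have "(2*N+1) * r < (2*N+1) * 2" using assms(3) by (simp only: mult.commute)
  then have "r < 2" unfolding mult_less_cancel1 by simp
  moreover have "r \<noteq> 0" "r \<noteq> 1" using r assms(2,4) by auto
  ultimately show False by simp
qed

text \<open>With \<open>d = 2 M + 1\<close>, in the block of indices \<open>a d, \<dots>, a d + d - 1\<close> exactly one factor of the numerator and one of
  the denominator vanish at \<open>z\<close>, and they cancel.\<close>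

lemma has_value_qratio_block:
  assumes z: "\<And>j. z ^ j = 1 \<longleftrightarrow> 2*M+1 dvd j"
  shows "\<exists>v. has_value z (\<Prod>i<2*M+1. qratio Q (a*(2*M+1) + i)) v"
proof -
  let ?d = "2*M+1"
  define num den where "num i = 1 - Q ^ (2*(a*?d+i)+1)" and "den i = 1 - Q ^ (2*(a*?d+i)+2)" for i
  have zd: "z ^ ?d = 1" by (simp only: z dvd_refl)
  have period: "z ^ (2*(a*?d+i)+j) = z ^ (2*i+j)" for i j
  proof -
    have "2*(a*?d+i)+j = (2*a) * ?d + (2*i+j)" by (simp add: algebra_simps)
    then show ?thesis by (metis power_add_period[OF zd])
  qed
  have num: "has_value z (\<Prod>i\<in>{..<?d}-{M}. num i) (\<Prod>i\<in>{..<?d}-{M}. 1 - z ^ (2*(a*?d+i)+1))"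
    unfolding num_def by (intro has_value_intros)
  have den: "has_value z (\<Prod>i\<in>{..<?d}-{2*M}. den i) (\<Prod>i\<in>{..<?d}-{2*M}. 1 - z ^ (2*(a*?d+i)+2))"
    unfolding den_def by (intro has_value_intros)
  have den0: "(\<Prod>i\<in>{..<?d}-{2*M}. 1 - z ^ (2*(a*?d+i)+2)) \<noteq> 0"
  proof -
    have "z ^ (2*i+2) \<noteq> 1" if "i \<in> {..<?d}-{2*M}" for i
      using that by (intro odd_order_power_neq_1[OF z]) (auto, presburger)
    then show ?thesis unfolding period by (subst prod_zero_iff) auto
  qed
  \<comment> \<open>\<open>2*(a*?d+M)+1 = (2*a+1)*?d\<close> and
    \<open>2*(a*?d+2*M)+2 = (2*a+2)*?d\<close>, so the two vanishing factors share
    \<open>1 - Q^?d\<close>. Since \<open>z^?d = 1\<close>, their cofactors take the nonzero values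
    \<open>2*a+1\<close> and \<open>2*a+2\<close>.\<close>
  have numM: "num M = (1 - Q ^ ?d) * qint (Q ^ ?d) (2*a+1)"
    unfolding num_def one_minus_times_qint power_mult[symmetric]
    by (rule arg_cong[where f = "\<lambda>j. 1 - Q ^ j"]) (simp add: algebra_simps)
  have denM: "den (2*M) = (1 - Q ^ ?d) * qint (Q ^ ?d) (2*a+2)"
    unfolding den_def one_minus_times_qint power_mult[symmetric]
    by (rule arg_cong[where f = "\<lambda>j. 1 - Q ^ j"]) (simp add: algebra_simps)
  have qi: "has_value z (qint (Q ^ ?d) m) (of_nat m)" for m
  proof -
    have "has_value z (qint (Q ^ ?d) m) (qint (z ^ ?d) m)"
      unfolding qint_def by (intro has_value_intros)
    then show ?thesis unfolding zd by (simp add: qint_def)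
  qed
  have "(\<Prod>i<?d. qratio Q (a*?d + i)) = (\<Prod>i<?d. num i) / (\<Prod>i<?d. den i)"
    unfolding qratio_def num_def den_def prod_dividef ..
  also have "\<dots> = (num M * (\<Prod>i\<in>{..<?d}-{M}. num i)) / (den (2*M) * (\<Prod>i\<in>{..<?d}-{2*M}. den i))"
    by (subst (1 2) prod.remove[of "{..<?d}"]) auto
  also have "\<dots> = qint (Q ^ ?d) (2*a+1) / qint (Q ^ ?d) (2*a+2)
      * ((\<Prod>i\<in>{..<?d}-{M}. num i) / (\<Prod>i\<in>{..<?d}-{2*M}. den i))"
    unfolding numM denM using indet_power_neq_1[of ?d] by simp
  finally have eq: "(\<Prod>i<?d. qratio Q (a*?d + i)) = \<dots>" .
  have "of_nat (2*a+2) \<noteq> (0::complex)" unfolding of_nat_eq_0_iff by simp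
  then show ?thesis unfolding eq
    by (intro exI) (rule has_value_mult[OF has_value_divide[OF qi qi] has_value_divide[OF num den den0]])
qed

text \<open>The first \<open>a\<close> full blocks contribute a value \<open>v\<close> common to all
  \<open>b\<close>, hence \<open>w = v^4\<close>; the remaining factors depend only on the offset,
  by periodicity.\<close>

lemma has_value_c_block:
  assumes z: "\<And>j. z ^ j = 1 \<longleftrightarrow> 2*M+1 dvd j" and "M > 0"
  shows "\<exists>w. \<forall>b<2*M+1. has_value z (c Q (a*(2*M+1)+b)) (w * c z b)"
proof -
  let ?d = "2*M+1"
  have zd: "z ^ ?d = 1" by (simp only: z dvd_refl)
  have z1: "z \<noteq> 1" using z[of 1] \<open>M > 0\<close> by auto
  note period = power_add_period[OF zd]
  have "\<exists>v. has_value z (\<Prod>i<a*?d. qratio Q i) v"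
  proof (induction a)
    case 0
    show ?case using has_value_1 by auto
  next
    case (Suc a)
    have "(\<Prod>i<Suc a*?d. qratio Q i) = (\<Prod>i<a*?d. qratio Q i) * (\<Prod>i<?d. qratio Q (a*?d + i))"
      unfolding mult_Suc add.commute[of ?d] by (rule prod_lessThan_add)
    then show ?case using Suc has_value_qratio_block[OF z, of a] by (metis has_value_mult)
  qed
  then obtain v where v: "has_value z (\<Prod>i<a*?d. qratio Q i) v" by blast
  have "has_value z (c Q (a*?d+b)) (v ^ 4 * c z b)" if "b < ?d" for b
  proof -
    have r: "has_value z (qratio Q (a*?d+i)) (qratio z i)" if "i < b" for i
    proof -
      have e: "2*(a*?d+i)+j = (2*a)*?d + (2*i+j)" for j by (simp add: algebra_simps)
      have per: "z ^ (2*(a*?d+i)+j) = z ^ (2*i+j)" for j unfolding e by (rule period)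
      \<comment> \<open>Only the last index \<open>2*M\<close> of a block has a vanishing
        denominator, and \<open>i < b\<close> never reaches it.\<close>
      have "z ^ (2*i+2) \<noteq> 1"
        using that \<open>b < ?d\<close> by (intro odd_order_power_neq_1[OF z]) (auto, presburger)
      then have "has_value z (qratio Q (a*?d+i)) (qratio z (a*?d+i))"
        by (intro has_value_qratio) (unfold per)
      then show ?thesis unfolding qratio_def per .
    qed
    have "4*(a*?d+b)+1 = (4*a)*?d + (4*b+1)" by (simp add: algebra_simps)
    then have "(1 - z) * qint z (4*(a*?d+b)+1) = (1 - z) * qint z (4*b+1)"
      unfolding one_minus_times_qint using period by metis
    then have "qint z (4*(a*?d+b)+1) = qint z (4*b+1)" using z1 by simp
    then have "has_value z (qint Q (4*(a*?d+b)+1)) (qint z (4*b+1))"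
      using has_value_qint by metis
    then have "has_value z (c Q (a*?d+b)) (qint z (4*b+1) * (v * (\<Prod>i<b. qratio z i)) ^ 4)"
      unfolding c_eq_qratio prod_lessThan_add using v r by (intro has_value_intros) auto
    then show ?thesis by (simp add: c_eq_qratio power_mult_distrib mult_ac)
  qed
  then show ?thesis by blast
qed


lemma has_value_c:
  assumes z: "\<And>j. z ^ j = 1 \<longleftrightarrow> 2*M+1 dvd j" and "b < 2*M+1"
  shows "has_value z (c Q b) (c z b)"
proof -
  have "z ^ (2*i+2) \<noteq> 1" if "i < b" for i
    using that \<open>b < 2*M+1\<close> by (intro odd_order_power_neq_1[OF z]) (auto, presburger)
  then show ?thesis unfolding c_eq_qratio
    by (intro has_value_mult has_value_power has_value_prod has_value_qint has_value_qratio) auto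
qed

lemma vanishes_double_sum:
  assumes z: "\<And>j. z ^ j = 1 \<longleftrightarrow> 2*M+1 dvd j" and "M > 0"
  shows "vanishes z 1 (\<Sum>k<m*(2*M+1). \<Sum>j\<le>k. c Q j * c Q (k - j))"
proof (rule vanishes_1_if_value_0)
  let ?d = "2*M+1"
  obtain W where W: "\<And>a b. b < ?d \<Longrightarrow> has_value z (c Q (a*?d+b)) (W a * c z b)"
    using has_value_c_block[OF z \<open>M > 0\<close>] by metis
  \<comment> \<open>Since \<open>c z i = 0\<close> for all \<open>i > M\<close>, the values in later
    blocks have to come from the block formula.\<close>
  define C where "C i = W (i div ?d) * c z (i mod ?d)" for i
  have "has_value z (c Q i) (C i)" for i
    using W[of "i mod ?d" "i div ?d"] unfolding C_def div_mult_mod_eq by simp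
  then have "has_value z (\<Sum>k<m*?d. \<Sum>j\<le>k. c Q j * c Q (k - j)) (\<Sum>k<m*?d. \<Sum>j\<le>k. C j * C (k - j))"
    by (intro has_value_sum has_value_mult)
  moreover have "(\<Sum>k<m*?d. \<Sum>j\<le>k. C j * C (k - j)) = 0"
  proof (rule double_sum_blocks_eq_0[where W = W and u = "c z" and M = M])
    show "C (a*?d+b) = W a * c z b" if "b < ?d" for a b
    proof -
      have "(a*?d+b) div ?d = a" using that by (subst div_mult_self3) auto
      moreover have "(a*?d+b) mod ?d = b" using that by (subst mod_mult_self3) auto
      ultimately show ?thesis unfolding C_def by (simp only:)
    qed
    show "c z b = 0" if "M < b" for b
      using that z by (intro c_eq_0) (simp_all only: dvd_refl)
    show "(\<Sum>b\<le>M. c z b) = 0" by (rule c_sum_eq_0(1)[OF z \<open>M > 0\<close>])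
  qed simp
  ultimately show "has_value z (\<Sum>k<m*?d. \<Sum>j\<le>k. c Q j * c Q (k - j)) 0" by simp
qed

lemma vanishes_qint:
  assumes "z ^ m = 1" "z \<noteq> 1"
  shows "vanishes z 1 (qint Q m)"
proof -
  have "qint z m = 0" using one_minus_times_qint[of z m] assms by simp
  then show ?thesis using has_value_qint[of z m] by (intro vanishes_1_if_value_0) simp
qed

section \<open>The perturbed sum and its expansion in \<open>y\<close>\<close>

definition pratio :: "'a::field \<Rightarrow> 'a \<Rightarrow> nat \<Rightarrow> 'a" where
  "pratio q y i = (1 - y * lsq q (2*i+1)) / (1 - y * lsq q (2*i+2))"

text \<open>\<open>pratio\<close> collects the dependence on \<open>Z\<close> and equals 1 at
  \<open>y = 0\<close>. The factors \<open>Z\<close> pulled out of numerator and denominator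
  cancel.\<close>

lemma wp_ratio_eq_pratio:
  fixes q Z :: "'a::field"
  assumes "Z \<noteq> 0" "q ^ (2*i+1) \<noteq> 1" "q ^ (2*i+2) \<noteq> 1"
  shows "wp_ratio q Z (q ^ (2*i)) = qratio q i ^ 4 * pratio q ((1 - Z)^2 / Z) i"
proof -
  have f: "(1 - Z*x) * (Z - x) = Z * ((1 - x)^2 * (1 - (1 - Z)^2 / Z * (x / (1 - x)^2)))" if "x \<noteq> 1" for x
  proof -
    have "(1 - x)^2 * (1 - (1 - Z)^2 / Z * (x / (1 - x)^2)) = (1 - x)^2 - (1 - Z)^2 / Z * x"
      using that by (simp add: right_diff_distrib)
    also have "Z * \<dots> = Z * (1 - x)^2 - (1 - Z)^2 * x"
      using assms(1) by (simp add: right_diff_distrib)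
    also have "\<dots> = (1 - Z*x) * (Z - x)" by (simp add: algebra_simps power2_eq_square)
    finally show ?thesis by simp
  qed
  have e: "q * q ^ (2*i) = q ^ (2*i+1)" "q^2 * q ^ (2*i) = q ^ (2*i+2)"
    by (simp_all add: power2_eq_square)
  have cancel: "a^2 * (Z * (a^2 * s)) / (b^2 * (Z * (b^2 * t))) = (a / b) ^ 4 * (s / t)" for a b s t :: 'a
    using assms(1) by (simp add: power_divide power4_eq_xxxx power2_eq_square mult_ac)
  show ?thesis
    unfolding wp_ratio_def e f[OF assms(2)] f[OF assms(3)] cancel qratio_def pratio_def lsq_def ..
qed

lemma c_pratio_sum:
  fixes q :: "'a::field"
  assumes q: "q \<noteq> 0" "\<And>i. i > 0 \<Longrightarrow> q ^ i \<noteq> 1" and Z: "Z = q ^ (2*N+1)"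
  shows "(\<Sum>k\<le>N. c q k * (\<Prod>i<k. pratio q ((1 - Z)^2 / Z) i)) = qint q (2*N+1) / q ^ N"
proof -
  have Z0: "Z \<noteq> 0" using q(1) Z by simp
  let ?R = "\<lambda>k. \<Prod>i<k. pratio q ((1 - Z)^2 / Z) i"
  have summand: "(1 - q * (q^(2*k))^2) * wp_prod q Z k = (1 - q) * (c q k * ?R k)" for k
  proof -
    have "q * (q^(2*k))^2 = q ^ (4*k+1)" by (simp add: power_mult[symmetric])
    then have "1 - q * (q^(2*k))^2 = (1 - q) * qint q (4*k+1)" by (simp only: one_minus_times_qint)
    moreover have "wp_prod q Z k = (\<Prod>i<k. qratio q i) ^ 4 * ?R k"
      unfolding wp_prod_def prod_power_distrib prod.distrib[symmetric]
      by (intro prod.cong refl wp_ratio_eq_pratio Z0 q(2)) auto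
    ultimately show ?thesis by (simp add: c_eq_qratio mult_ac)
  qed
  have "q ^ N * ((1 - q) * (\<Sum>k\<le>N. c q k * ?R k)) = (1 - q) * qint q (2*N+1)"
    using wp_sum[OF q, of N] unfolding Z[symmetric] summand sum_distrib_left[symmetric]
    by (simp only: one_minus_times_qint Z)
  moreover have "1 - q \<noteq> 0" using q(2)[of 1] by simp
  ultimately have "q ^ N * (\<Sum>k\<le>N. c q k * ?R k) = qint q (2*N+1)"
    by (simp add: mult.left_commute)
  then show ?thesis using q(1) by (simp add: divide_simps mult.commute)
qed

text \<open>Each remainder is a multiple of \<open>y^2\<close>, which has order 4; the condition on
  \<open>z\<close> keeps every \<open>lsq\<close> involved regular.\<close>

lemma vanishes_pratio_prod:
  assumes "vanishes z 2 y" and z: "\<And>j. 0 < j \<Longrightarrow> j \<le> 2*k \<Longrightarrow> z ^ j \<noteq> 1"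
  shows "vanishes z 4 ((\<Prod>i<k. pratio Q y i) - (1 + y * dlog Q k))"
  using z
proof (induction k)
  case 0
  then show ?case by (simp add: dlog_def vanishes_zero)
next
  case (Suc k)
  define a b D where "a = lsq Q (2*k+1)" and "b = lsq Q (2*k+2)" and "D = dlog Q k"
  define R where "R = (\<Prod>i<k. pratio Q y i)"
  have y0: "has_value z y 0"
  proof -
    obtain B v where "has_value z B v" "y = to_fract [:- z, 1:] ^ 2 * B"
      using assms(1) unfolding vanishes_def by blast
    then show ?thesis
      using has_value_mult[OF has_value_power[OF has_value_to_fract[of z "[:- z, 1:]"], of 2], of B v] by simp
  qed
  have y2: "vanishes z 4 (y^2)" using vanishes_power[OF assms(1), of 2] by simp
  have a: "has_value z a (lsq z (2*k+1))" and b: "has_value z b (lsq z (2*k+2))"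
    unfolding a_def b_def by (intro has_value_lsq Suc.prems; simp)+
  have D: "has_value z D (dlog z k)"
    unfolding D_def dlog_def
    by (intro has_value_sum has_value_diff has_value_lsq Suc.prems) auto
  have inv: "has_value z (1 / (1 - y * b)) 1"
    using has_value_divide[OF has_value_1 has_value_diff[OF has_value_1 has_value_mult[OF y0 b]]] by simp
  have nz: "1 - y * b \<noteq> 0"
    using has_value_diff[OF has_value_1 has_value_mult[OF y0 b]] by (auto dest: has_value_nonzero)
  have IH: "vanishes z 4 (R - (1 + y * D))" unfolding R_def D_def using Suc by simp
  have "has_value z (1 - y * a) (1 - 0 * lsq z (2*k+1))"
    by (intro has_value_diff has_value_1 has_value_mult y0 a)
  then have p: "has_value z (pratio Q y k) (1 * 1)"
    using has_value_mult[OF _ inv] unfolding pratio_def a_def b_def by force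
  have new: "pratio Q y k - (1 + y * (b - a)) = y^2 * (b * (b - a) * (1 / (1 - y * b)))"
    unfolding pratio_def a_def[symmetric] b_def[symmetric] using nz
    by (simp add: divide_simps) (simp add: algebra_simps power2_eq_square)
  \<comment> \<open>The three terms are the error of the earlier factors, the error of the new
    factor, and the quadratic cross term.\<close>
  have "vanishes z 4 ((R - (1 + y * D)) * pratio Q y k
      + (y^2 * (b * (b - a) * (1 / (1 - y * b)))) * (1 + y * D) + y^2 * (D * (b - a)))"
    by (intro vanishes_add vanishes_mult_regular[OF IH p] vanishes_mult_regular[OF vanishes_mult_regular[OF y2
          has_value_mult[OF has_value_mult[OF b has_value_diff[OF b a]] inv]]
        has_value_add[OF has_value_1 has_value_mult[OF y0 D]]]
      vanishes_mult_regular[OF y2 has_value_mult[OF D has_value_diff[OF b a]]])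
  also have "(R - (1 + y * D)) * pratio Q y k
      + (y^2 * (b * (b - a) * (1 / (1 - y * b)))) * (1 + y * D) + y^2 * (D * (b - a))
      = R * pratio Q y k - (1 + y * (D + (b - a)))"
    unfolding new[symmetric] by (simp add: algebra_simps power2_eq_square)
  finally show ?case by (simp add: R_def D_def a_def b_def dlog_def)
qed

lemma vanishes_primitive:
  assumes z: "\<And>j. z ^ j = 1 \<longleftrightarrow> 2*N+1 dvd j" and "N > 0"
  shows "vanishes z 4 ((\<Sum>k<2*N+1. \<Sum>j\<le>k. c Q j * c Q (k - j)) - (qint Q (2*N+1) / Q ^ N)^2)"
proof -
  let ?n = "2*N+1"
  define Z y where "Z = Q ^ ?n" and "y = (1 - Z)^2 / Z"
  define S T where "S = (\<Sum>k\<le>N. c Q k)" and "T = qint Q ?n / Q ^ N"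
  have zn: "z ^ ?n = 1" by (simp only: z dvd_refl)
  have z0: "z \<noteq> 0" using zn by (auto simp: power_0_left)
  have z1: "z \<noteq> 1" using z[of 1] \<open>N > 0\<close> by auto
  have zj: "z ^ j \<noteq> 1" if "0 < j" "j < ?n" for j
    unfolding z using that by (auto dest: dvd_imp_le)
  have hc: "has_value z (c Q k) (c z k)" if "k < ?n" for k
    by (rule has_value_c[OF z that])
  have Zn: "vanishes z 1 (1 - Z)"
    using has_value_diff[OF has_value_1 has_value_power[OF has_value_indet[of z], of ?n]]
    unfolding Z_def zn by (intro vanishes_1_if_value_0) simp
  have "has_value z (1 / Z) (1 / 1)"
    unfolding Z_def zn[symmetric] by (intro has_value_divide has_value_power has_value_indet)
      (use zn has_value_1 in auto)
  then have y: "vanishes z 2 y"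
    using vanishes_mult_regular[OF vanishes_power[OF Zn, of 2]] unfolding y_def by fastforce
  have "vanishes z 1 (qint Q ?n * (1 / Q ^ N))"
    by (rule vanishes_mult_regular[OF vanishes_qint[OF zn z1]
        has_value_divide[OF has_value_1 has_value_power[OF has_value_indet]]]) (use z0 in simp)
  then have T: "vanishes z 1 T" by (simp add: T_def)

  have ST: "vanishes z 3 (S - T)"
  proof -
    let ?R = "\<lambda>k. \<Prod>i<k. pratio Q y i"
    have "T = (\<Sum>k\<le>N. c Q k * ?R k)"
      unfolding T_def y_def
      by (rule c_pratio_sum[OF indet_nonzero indet_power_neq_1 Z_def, symmetric])
    \<comment> \<open>The remainders vanish to order 4; the term linear in \<open>y\<close> reaches
      order 3 because its coefficient is 0 at \<open>z\<close> by antisymmetry.\<close>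
    then have "S - T = - ((\<Sum>k\<le>N. (?R k - (1 + y * dlog Q k)) * c Q k) + y * (\<Sum>k\<le>N. c Q k * dlog Q k))"
      unfolding S_def by (simp add: algebra_simps sum.distrib sum_subtractf sum_distrib_left)
    moreover have "vanishes z 3 (\<Sum>k\<le>N. (?R k - (1 + y * dlog Q k)) * c Q k)"
      using zj by (intro vanishes_sum vanishes_mult_regular[OF _ hc]
        vanishes_mono[OF vanishes_pratio_prod[OF y]]) auto
    moreover have "has_value z (\<Sum>k\<le>N. c Q k * dlog Q k) (\<Sum>k\<le>N. c z k * dlog z k)"
      unfolding dlog_def
      by (intro has_value_sum has_value_mult has_value_diff has_value_lsq hc zj) auto
    then have "vanishes z (2 + 1) (y * (\<Sum>k\<le>N. c Q k * dlog Q k))"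
      using c_sum_eq_0(2)[OF z \<open>N > 0\<close>] by (intro vanishes_mult y vanishes_1_if_value_0) simp
    ultimately show ?thesis by (simp add: vanishes_uminus vanishes_diff)
  qed
  \<comment> \<open>\<open>S + T\<close>, written through \<open>S - T\<close> and \<open>T\<close>,
    vanishes to order 1, so the product \<open>(S - T) * (S + T)\<close> reaches order 3 +
    1.\<close>
  have "vanishes z 1 ((S - T) + (T + T))"
    by (intro vanishes_add T vanishes_mono[OF ST]) simp
  then have "vanishes z (3 + 1) ((S - T) * ((S - T) + (T + T)))"
    by (rule vanishes_mult[OF ST])
  then have SST: "vanishes z 4 (S^2 - T^2)"
    by (simp add: algebra_simps power2_eq_square)

  \<comment> \<open>The factor \<open>i = N\<close> of the product is 0 at \<open>z\<close>, and
    \<open>c\<close> contains the fourth power of that product.\<close>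
  have large: "vanishes z 4 (c Q k)" if "N < k" "k < ?n" for k
  proof -
    have "z ^ (2*i+2) \<noteq> 1" if "i < k" for i
      using that \<open>k < ?n\<close> by (intro odd_order_power_neq_1[OF z]) (auto, presburger)
    then have "has_value z (\<Prod>i<k. qratio Q i) (\<Prod>i<k. qratio z i)"
      by (intro has_value_prod has_value_qratio) auto
    moreover have "(\<Prod>i<k. qratio z i) = 0"
      using \<open>N < k\<close> zn by (intro prod_zero) (auto simp: qratio_def intro!: bexI[of _ N])
    ultimately have "vanishes z 1 (\<Prod>i<k. qratio Q i)"
      by (intro vanishes_1_if_value_0) simp
    from vanishes_mult_regular[OF vanishes_power[OF this, of 4] has_value_qint[of z "4*k+1"]]
    show ?thesis by (simp add: c_eq_qratio mult.commute)
  qed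
  \<comment> \<open>As \<open>N + N < ?n\<close>, the square \<open>?B\<close> lies in the triangle
    \<open>?A\<close>; every other pair has an index above \<open>N\<close> and below
    \<open>?n\<close>, where \<open>large\<close> applies.\<close>
  let ?A = "{(i, j). i + j < ?n}" and ?B = "{..N} \<times> {..N}"
  have fin: "finite ?A"
    by (rule finite_subset[of _ "{..<?n} \<times> {..<?n}"]) auto
  have "(\<Sum>k<?n. \<Sum>j\<le>k. c Q j * c Q (k - j)) = (\<Sum>(i, j)\<in>?A. c Q i * c Q j)"
    by (rule sum.triangle_reindex[symmetric])
  also have "\<dots> = (\<Sum>(i, j)\<in>?A - ?B. c Q i * c Q j) + (\<Sum>(i, j)\<in>?B. c Q i * c Q j)"
    by (rule sum.subset_diff[OF _ fin]) auto
  also have "(\<Sum>(i, j)\<in>?B. c Q i * c Q j) = S^2"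
    unfolding S_def power2_eq_square sum_product sum.cartesian_product ..
  finally have eq: "(\<Sum>k<?n. \<Sum>j\<le>k. c Q j * c Q (k - j)) - T^2
      = (\<Sum>(i, j)\<in>?A - ?B. c Q i * c Q j) + (S^2 - T^2)" by simp
  have "vanishes z 4 (\<Sum>(i, j)\<in>?A - ?B. c Q i * c Q j)"
  proof (rule vanishes_sum)
    fix p assume "p \<in> ?A - ?B"
    then obtain i j where p: "p = (i, j)" and ij: "i + j < ?n" "N < i \<or> N < j" by fastforce
    from ij(2) show "vanishes z 4 (case p of (i, j) \<Rightarrow> c Q i * c Q j)"
      unfolding p prod.case
    proof
      assume "N < i"
      then show "vanishes z 4 (c Q i * c Q j)" using ij by (intro vanishes_mult_regular[OF large hc]) auto
    next
      assume "N < j"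
      then show "vanishes z 4 (c Q i * c Q j)" using ij by (subst mult.commute, intro vanishes_mult_regular[OF large hc]) auto
    qed
  qed
  then show ?thesis using SST unfolding T_def[symmetric] eq by (rule vanishes_add)
qed

section \<open>Roots of unity and the factors of the modulus\<close>

lemma order_exists:
  fixes z :: complex
  assumes "z ^ n = 1" "n > 0"
  shows "\<exists>d>0. \<forall>j. z ^ j = 1 \<longleftrightarrow> d dvd j"
proof -
  define d where "d = (LEAST j. j > 0 \<and> z ^ j = 1)"
  have d: "d > 0 \<and> z ^ d = 1" unfolding d_def by (rule LeastI[of _ n]) (use assms in auto)
  have min: "\<not> (j > 0 \<and> z ^ j = 1)" if "j < d" for j
    using not_less_Least that unfolding d_def .
  have "z ^ j = 1 \<longleftrightarrow> d dvd j" for j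
  proof -
    have "z ^ j = z ^ (j mod d)"
      using power_add_period[of z d "j div d" "j mod d"] d by simp
    then show ?thesis
      using min[of "j mod d"] d by (auto simp: dvd_eq_mod_eq_0)
  qed
  then show ?thesis using d by blast
qed

lemma cis_power_eq_1D:
  assumes "cis (2 * pi * real k / real n) ^ j = 1" "n > 0"
  shows "n dvd k * j"
proof -
  have "cos (real j * (2 * pi * real k / real n)) = 1"
    using assms(1) unfolding DeMoivre by (metis cis.simps(1) one_complex.simps(1))
  then obtain m where "real j * (2 * pi * real k / real n) = real_of_int m * 2 * pi"
    unfolding cos_one_2pi_int by blast
  then have "real j * real k = real_of_int m * real n"
    using assms(2) by (simp add: field_simps)
  then have "real_of_int (int (k * j)) = real_of_int (m * int n)" by (simp add: mult.commute)
  then have "int (k * j) = m * int n" unfolding of_int_eq_iff .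
  then show ?thesis by (metis dvd_triv_right int_dvd_int_iff)
qed

text \<open>Each nontrivial root of unity is a zero and the linear factors are coprime, so the
  product divides; both sides are monic of degree \<open>n - 1\<close>, so the quotient is
  1.\<close>

lemma qint_indet_eq_prod:
  assumes "n > 0"
  shows "qint indet n = (\<Prod>k\<in>{1..<n}. [:- cis (2 * pi * real k / real n), 1:])"
proof -
  let ?r = "\<lambda>k. cis (2 * pi * real k / real n)"
  let ?P = "\<Prod>k\<in>{1..<n}. [:- ?r k, 1:]"
  have bij: "bij_betw ?r {..<n} {z. z ^ n = 1}" by (rule bij_betw_roots_unity[OF assms])
  then have inj: "inj_on ?r {..<n}" by (rule bij_betw_imp_inj_on)
  have "[:- ?r k, 1:] dvd qint indet n" if "k \<in> {1..<n}" for k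
  proof -
    have "?r k ^ n = 1" using bij that by (auto simp: bij_betw_def)
    moreover have "?r k \<noteq> 1" using inj_onD[OF inj, of k 0] that assms by auto
    ultimately have "qint (?r k) n = 0" using one_minus_times_qint[of "?r k" n] by simp
    then have "poly (qint indet n) (?r k) = 0"
      by (simp add: qint_def poly_sum indet_def)
    then show ?thesis unfolding poly_eq_0_iff_dvd .
  qed
  moreover have "coprime [:- ?r i, 1:] [:- ?r j, 1:]" if "i \<in> {1..<n}" "j \<in> {1..<n}" "i \<noteq> j" for i j
    using inj_onD[OF inj, of i j] that by (auto simp: coprime_linear_iff)
  ultimately have "?P dvd qint indet n" by (intro prod_coprime_dvd) auto
  then obtain W where W: "qint indet n = ?P * W" by blast
  have co: "coeff (qint indet n) j = (if j < n then 1 else 0)" for j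
    unfolding qint_def indet_def by (simp add: coeff_sum monom_altdef[of 1, simplified, symmetric])
  then have "degree (qint indet n) = n - 1"
    using assms by (intro antisym degree_le le_degree) auto
  then have lc: "lead_coeff (qint indet n) = 1" using co assms by simp
  have P: "degree ?P = n - 1" "lead_coeff ?P = 1"
    by (subst degree_prod_eq_sum_degree; simp) (simp add: lead_coeff_prod)
  have "W \<noteq> 0" using W lc by auto
  then have "degree (qint indet n) = degree ?P + degree W"
    unfolding W using P by (intro degree_mult_eq) auto
  then have "degree W = 0" using P \<open>degree (qint indet n) = n - 1\<close> by simp
  then obtain w where w: "W = [:w:]" by (metis degree_eq_zeroE)
  have "lead_coeff W = 1" using lc unfolding W lead_coeff_mult P(2) by (simp only: mult_1)
  then show ?thesis using W unfolding w by simp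
qed

lemma qint_times_cyclotomic_power:
  assumes "n > 1"
  shows "qint indet n * cyclotomic n ^ m =
    (\<Prod>k\<in>{1..<n}. [:- cis (2 * pi * real k / real n), 1:] ^ (if coprime k n then Suc m else 1))"
proof -
  let ?r = "\<lambda>k. [:- cis (2 * pi * real k / real n), 1:]"
  \<comment> \<open>For \<open>n > 1\<close> the index \<open>k = n\<close> is not coprime to
    \<open>n\<close> and drops out.\<close>
  have primitive: "{k. 1 \<le> k \<and> k \<le> n \<and> coprime k n} = {k \<in> {1..<n}. coprime k n}"
    using assms by (auto simp: le_less)
  have "cyclotomic n ^ m = (\<Prod>k\<in>{1..<n}. if coprime k n then ?r k ^ m else 1)"
    unfolding cyclotomic_def primitive prod_power_distrib by (rule prod.inter_filter) simp
  then show ?thesis using assms unfolding qint_indet_eq_prod[OF less_trans[OF zero_less_one assms]]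
    by (auto simp: prod.distrib[symmetric] intro!: prod.cong)
qed

theorem theorem1p4:
  fixes n :: nat and q :: "complex poly fract"
  assumes "n > 0" and "odd n"
  defines "q \<equiv> to_fract indet"
  shows "ratfun_cong
           (\<Sum>k=0..n-1. \<Sum>j=0..k. c q j * c q (k - j))
           (q powi (1 - int n) * (qint q n) ^ 2)
           (qint indet n * cyclotomic n ^ 3)"
proof (cases "n = 1")
  case True
  have "c q 0 = 1" by (simp add: c_def qpoch_def qint_def)
  then show ?thesis using True unfolding ratfun_cong_def
    by (intro exI[of _ 0] exI[of _ 1]) (simp add: qint_def)
next
  case False
  then have "n > 1" using assms(1) by simp
  obtain N where N: "n = 2*N+1" using assms(2) by (auto elim: oddE)
  define r where "r k = cis (2 * pi * real k / real n)" for k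
  have bij: "bij_betw r {..<n} {z. z ^ n = 1}"
    unfolding r_def by (rule bij_betw_roots_unity[OF assms(1)])
  have sum: "(\<Sum>k=0..n-1. \<Sum>j=0..k. c q j * c q (k - j)) = (\<Sum>k<n. \<Sum>j\<le>k. c Q j * c Q (k - j))"
    using assms(1) by (simp add: q_def atLeast0AtMost flip: lessThan_Suc_atMost)
  \<comment> \<open>The even exponent makes the right side a perfect square.\<close>
  have "1 - int n = - int (2*N)" using N by simp
  then have rhs: "q powi (1 - int n) * qint q n ^ 2 = (qint Q n / Q ^ N)^2"
    unfolding q_def
    by (simp only: power_int_minus power_int_of_nat power_even_eq power_divide)
      (simp add: field_class.field_divide_inverse)
  \<comment> \<open>At a primitive root, \<open>Suc 3\<close> counts one zero from
    \<open>qint\<close> and three from the cube of the cyclotomic polynomial.\<close>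
  have "vanishes (r k) (if coprime k n then Suc 3 else 1)
      ((\<Sum>k<n. \<Sum>j\<le>k. c Q j * c Q (k - j)) - (qint Q n / Q ^ N)^2)" if "k \<in> {1..<n}" for k
  proof -
    have rn: "r k ^ n = 1" using bij that by (auto simp: bij_betw_def)
    have r1: "r k \<noteq> 1" using inj_onD[OF bij_betw_imp_inj_on[OF bij], of k 0] that by (auto simp: r_def)
    obtain d where d: "d > 0" "\<And>j. r k ^ j = 1 \<longleftrightarrow> d dvd j"
      using order_exists[OF rn assms(1)] by blast
    then have "d dvd n" using rn by blast
    then have "odd d" using assms(2) by (metis dvd_trans)
    then obtain M where M: "d = 2*M+1" by (auto elim: oddE)
    have "d \<noteq> 1" using d(2)[of 1] r1 by auto
    then have "M > 0" using M by simp
    show ?thesis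
    proof (cases "coprime k n")
      case True
      have "r k ^ d = 1" using d(2) by simp
      then have "n dvd k * d" unfolding r_def using assms(1) by (rule cis_power_eq_1D)
      then have "n dvd d" using True by (simp add: coprime_commute coprime_dvd_mult_right_iff)
      then have "d = n" using \<open>d dvd n\<close> by (simp add: dvd_antisym)
      then show ?thesis
        using vanishes_primitive[of "r k" N] d(2) N \<open>d \<noteq> 1\<close> True by simp
    next
      case False
      \<comment> \<open>Only a simple zero is required here, and each side has one separately: the
        right side through \<open>qint\<close>, the double sum through its \<open>m\<close> blocks
        of length \<open>d\<close>.\<close>
      obtain m where m: "n = m * d" using \<open>d dvd n\<close> by (metis dvdE mult.commute)
      have "r k \<noteq> 0" by (simp add: r_def)
      then have "vanishes (r k) 1 (qint Q n * (qint Q n / Q ^ (2*N)))"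
        by (intro vanishes_mult_regular[OF vanishes_qint[OF rn r1]
              has_value_divide[OF has_value_qint has_value_power[OF has_value_indet]]]) simp
      then have "vanishes (r k) 1 ((qint Q n / Q ^ N)^2)"
        by (simp add: power_divide power_even_eq power2_eq_square)
      moreover have "vanishes (r k) 1 (\<Sum>k<n. \<Sum>j\<le>k. c Q j * c Q (k - j))"
        unfolding m M using d(2) M by (intro vanishes_double_sum \<open>M > 0\<close>) simp
      ultimately show ?thesis using False by (simp add: vanishes_diff)
    qed
  qed
  moreover have "inj_on r {1..<n}"
    by (rule inj_on_subset[OF bij_betw_imp_inj_on[OF bij]]) auto
  ultimately show ?thesis
    unfolding sum rhs qint_times_cyclotomic_power[OF \<open>n > 1\<close>] r_def[symmetric]
    by (intro ratfun_cong_if_vanishes) auto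
qed

end
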